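(* Let $d\geq 1$ be an integer. For each nonempty bounded subset $F$ of $\mathbb{R}^d$, let $\mathcal{D}_d^F$ denote the set of all degenerate balls in $\ell_\infty^d$ containing $F$. Then $\mathrm{VC\text{-}dim}(\mathcal{D}_d^F)=\lfloor 3d/2\rfloor$.
   Context: $\ell_\infty^d$ denotes $\mathbb{R}^d$ equipped with the norm $\|\mathbf{x}\|_\infty=\max\{|x_1|,\dots,|x_d|\}$. A (closed) degenerate ball in $\ell_\infty^d$ is any set of the form $\prod_{i=1}^d I_i\subset\mathbb{R}^d$, where each $I_i$ is a closed interval unbounded to at least one side, i.e. each $I_i$ is of the form $(-\infty,a]$, $[a,\infty)$ (with $a\in\mathbb{R}$), or $\mathbb{R}$. For $F\subset\mathbb{R}^d$, $\mathcal{D}_d^F$ is the set of all degenerate balls $D$ in $\ell_\infty^d$ with $F\subset D$. A family $\mathcal{E}$ of subsets of a set $X$ shatters a finite set $\sigma\subset X$ if for every $\sigma'\subset\sigma$ there is $C\in\mathcal{E}$ with $C\cap\sigma=\sigma'$. The Vapnik-Chervonenkis dimension is $\mathrm{VC\text{-}dim}(\mathcal{E})=\sup\{\#\sigma : \sigma\subset X \text{ is finite and } \mathcal{E} \text{ shatters } \sigma\}$. *)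

theory Defs
  imports "HOL-Analysis.Analysis"
begin

definition shatters :: "'a set set \<Rightarrow> 'a set \<Rightarrow> bool" where
  "shatters E \<sigma> \<longleftrightarrow> (\<forall>\<sigma>'\<subseteq>\<sigma>. \<exists>C\<in>E. C \<inter> \<sigma> = \<sigma>')"

text \<open>The supremum is taken in \<^typ>\<open>enat\<close>, so that an unbounded set of
  cardinalities gives the value \<open>\<infinity>\<close>.\<close>

definition VC_dim :: "'a set set \<Rightarrow> enat" where
  "VC_dim E = Sup {enat (card \<sigma>) | \<sigma>. finite \<sigma> \<and> shatters E \<sigma>}"

definition unbounded_closed_interval :: "real set \<Rightarrow> bool" where
  "unbounded_closed_interval I \<longleftrightarrow> (\<exists>a. I = {..a}) \<or> (\<exists>a. I = {a..}) \<or> I = UNIV"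

text \<open>\<open>real ^ 'n\<close> stands for the underlying vector space of \<open>\<ell>\<^sub>\<infinity>\<^sup>d\<close> with
  \<open>d = CARD('n)\<close>. The max norm itself does not enter the definition.\<close>

definition degenerate_ball :: "(real ^ 'n) set \<Rightarrow> bool" where
  "degenerate_ball D \<longleftrightarrow>
     (\<exists>I :: 'n \<Rightarrow> real set. (\<forall>i. unbounded_closed_interval (I i)) \<and> D = {x. \<forall>i. x $ i \<in> I i})"

definition degenerate_balls_containing :: "(real ^ 'n) set \<Rightarrow> (real ^ 'n) set set" where
  "degenerate_balls_containing F = {D. degenerate_ball D \<and> F \<subseteq> D}"

end

theory Submission
  imports Defs
begin

text \<open>Upper bound: each of the \<open>2 d\<close> signed coordinate directions has a top point of the shattered
  set \<open>\<sigma>\<close>, and any nonempty cut in that direction removes its top. Removing a single point \<open>x\<close>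
  shows that \<open>x\<close> is the top of some direction. If \<open>x\<close> and \<open>y\<close> were each top of only one direction,
  and these two directions were opposite, then \<open>x\<close> and \<open>y\<close> could not be removed together. So at most
  \<open>d\<close> points are top of only one direction, and double counting gives \<open>2 |\<sigma>| - d \<le> 2 d\<close>.

  Lower bound: two coordinates carry three points \<open>(3K, 2K)\<close>, \<open>(2K, 3K)\<close>, \<open>(-2K, -2K)\<close> that can be
  removed independently of one another, and a leftover coordinate carries one point.\<close>

text \<open>A pair \<open>(i, b)\<close> is one of the 2d signed coordinate directions,
  \<open>True\<close> being the increasing one. Upper and lower bounds thus become the same kind of
  cut.\<close>

definition directed_coord :: "'n \<times> bool \<Rightarrow> real ^ 'n \<Rightarrow> real" where
  "directed_coord e x = (if snd e then x $ fst e else - (x $ fst e))"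

lemma VC_dim_eqI:
  assumes "finite \<sigma>" "shatters E \<sigma>" "card \<sigma> = n"
    and "\<And>\<tau>. finite \<tau> \<Longrightarrow> shatters E \<tau> \<Longrightarrow> card \<tau> \<le> n"
  shows "VC_dim E = enat n"
  unfolding VC_dim_def
proof (rule antisym)
  show "Sup {enat (card \<sigma>) |\<sigma>. finite \<sigma> \<and> shatters E \<sigma>} \<le> enat n"
    by (rule Sup_least) (use assms(4) in auto)
  show "enat n \<le> Sup {enat (card \<sigma>) |\<sigma>. finite \<sigma> \<and> shatters E \<sigma>}"
    by (rule Sup_upper) (use assms(1-3) in auto)
qed

text \<open>Applied to singletons \<open>A\<close>, the hypothesis separates any two indices, so
  distinctness of the points comes along with shattering.\<close>

lemma shatters_imageI:
  assumes "\<And>A. A \<subseteq> J \<Longrightarrow> \<exists>C\<in>E. \<forall>j\<in>J. p j \<in> C \<longleftrightarrow> j \<in> A"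
  shows "shatters E (p ` J)" and "inj_on p J"
proof -
  show "shatters E (p ` J)"
    unfolding shatters_def
  proof (intro allI impI)
    fix \<sigma>' assume sub: "\<sigma>' \<subseteq> p ` J"
    obtain C where "C \<in> E" "\<forall>j\<in>J. p j \<in> C \<longleftrightarrow> j \<in> {j\<in>J. p j \<in> \<sigma>'}"
      using assms[of "{j\<in>J. p j \<in> \<sigma>'}"] by auto
    then show "\<exists>C\<in>E. C \<inter> p ` J = \<sigma>'"
      using sub by (intro bexI[of _ C]) auto
  qed
  show "inj_on p J"
  proof (rule inj_onI)
    fix i j assume "i \<in> J" "j \<in> J" "p i = p j"
    then obtain C where C: "\<forall>k\<in>J. p k \<in> C \<longleftrightarrow> k \<in> {i}"
      using assms[of "{i}"] by blast
    then have "p j \<in> C" using \<open>i \<in> J\<close> \<open>p i = p j\<close> by auto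
    then show "i = j" using C \<open>j \<in> J\<close> by auto
  qed
qed

text \<open>Each factor bounds its coordinate on at most one side, so one sign choice
  \<open>s\<close>, fixed before \<open>x\<close>, serves all excluded points. The bound violated by
  \<open>x\<close> holds on \<open>F\<close> and fails for everything at least as far out as
  \<open>x\<close>.\<close>

lemma degenerate_ball_cut:
  assumes "D \<in> degenerate_balls_containing F"
  obtains s where "\<And>x. x \<notin> D \<Longrightarrow> \<exists>i. (\<forall>f\<in>F. directed_coord (i, s i) f < directed_coord (i, s i) x) \<and>
    (\<forall>y. directed_coord (i, s i) x \<le> directed_coord (i, s i) y \<longrightarrow> y \<notin> D)"
proof -
  obtain I where I: "\<And>i. unbounded_closed_interval (I i)" and D: "D = {x. \<forall>i. x $ i \<in> I i}"
    and F: "F \<subseteq> D"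
    using assms unfolding degenerate_balls_containing_def degenerate_ball_def by auto
  \<comment> \<open>For \<open>I i = UNIV\<close> this gives False, harmlessly: such a coordinate
    excludes no point.\<close>
  define s where "s i \<longleftrightarrow> (\<exists>a. I i = {..a})" for i
  show thesis
  proof (rule that[of s])
    fix x assume "x \<notin> D"
    then obtain i where i: "x $ i \<notin> I i" using D by auto
    have "(\<forall>f\<in>F. directed_coord (i, s i) f < directed_coord (i, s i) x) \<and>
      (\<forall>y. directed_coord (i, s i) x \<le> directed_coord (i, s i) y \<longrightarrow> y \<notin> D)"
    proof (cases "s i")
      case True
      then obtain a where a: "I i = {..a}" by (auto simp: s_def)
      have "f $ i \<le> a" if "f \<in> D" for f using that a unfolding D by fastforce
      then show ?thesis using a i F True by (fastforce simp: directed_coord_def)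
    next
      case False
      then obtain a where a: "I i = {a..}"
        using I[of i] i by (auto simp: s_def unbounded_closed_interval_def)
      have "a \<le> f $ i" if "f \<in> D" for f using that a unfolding D by fastforce
      then show ?thesis using a i F False by (fastforce simp: directed_coord_def)
    qed
    then show "\<exists>i. (\<forall>f\<in>F. directed_coord (i, s i) f < directed_coord (i, s i) x) \<and>
      (\<forall>y. directed_coord (i, s i) x \<le> directed_coord (i, s i) y \<longrightarrow> y \<notin> D)" by blast
  qed
qed

lemma shattered_card_bound:
  fixes F :: "(real ^ 'n) set"
  assumes "F \<noteq> {}" "finite \<sigma>" and sh: "shatters (degenerate_balls_containing F) \<sigma>"
  shows "2 * card \<sigma> \<le> 3 * CARD('n)"
proof (cases "\<sigma> = {}")
  case False
  obtain f where f: "f \<in> F" using assms(1) by blast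
  have "\<exists>t\<in>\<sigma>. \<forall>y\<in>\<sigma>. directed_coord e y \<le> directed_coord e t" for e
  proof -
    have "Max (directed_coord e ` \<sigma>) \<in> directed_coord e ` \<sigma>"
      using assms(2) False by (intro Max_in) auto
    then obtain t where "t \<in> \<sigma>" "directed_coord e t = Max (directed_coord e ` \<sigma>)" by auto
    then show ?thesis using assms(2) by (intro bexI[of _ t]) auto
  qed
  then obtain top where top: "\<And>e. top e \<in> \<sigma>"
    and top_max: "\<And>e y. y \<in> \<sigma> \<Longrightarrow> directed_coord e y \<le> directed_coord e (top e)"
    by metis
  \<comment> \<open>Take a ball removing exactly \<open>\<tau>\<close>: the bound that excludes
    \<open>x\<close> also excludes the top of its direction, which lies in \<open>\<sigma>\<close>,
    hence in \<open>\<tau>\<close>.\<close>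
  have cut: "\<exists>s. \<forall>x\<in>\<tau>. \<exists>i. directed_coord (i, s i) f < directed_coord (i, s i) x \<and> top (i, s i) \<in> \<tau>"
    if "\<tau> \<subseteq> \<sigma>" for \<tau>
  proof -
    obtain D where D: "D \<in> degenerate_balls_containing F" "D \<inter> \<sigma> = \<sigma> - \<tau>"
      using sh that unfolding shatters_def by (metis Diff_subset)
    obtain s where s: "\<And>x. x \<notin> D \<Longrightarrow> \<exists>i. (\<forall>f\<in>F. directed_coord (i, s i) f < directed_coord (i, s i) x) \<and>
        (\<forall>y. directed_coord (i, s i) x \<le> directed_coord (i, s i) y \<longrightarrow> y \<notin> D)"
      using degenerate_ball_cut[OF D(1)] by blast
    show ?thesis
    proof (intro exI[of _ s] ballI)
      fix x assume x: "x \<in> \<tau>"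
      then have "x \<notin> D" "x \<in> \<sigma>" using D(2) that by auto
      then obtain i where "\<forall>f\<in>F. directed_coord (i, s i) f < directed_coord (i, s i) x"
        and "top (i, s i) \<notin> D"
        using s top_max by meson
      then show "\<exists>i. directed_coord (i, s i) f < directed_coord (i, s i) x \<and> top (i, s i) \<in> \<tau>"
        using f top D(2) by blast
    qed
  qed
  have single: "\<exists>e. directed_coord e f < directed_coord e x \<and> top e = x" if "x \<in> \<sigma>" for x
    using cut[of "{x}"] that by auto
  \<comment> \<open>One chosen top per direction makes the fibres disjoint, so their sizes sum to 2d
    even when maxima are tied.\<close>
  define fib where "fib x = {e. top e = x}" for x
  define N where "N = {x\<in>\<sigma>. card (fib x) = 1}"
  have "\<forall>x\<in>N. \<exists>e. fib x = {e}" by (auto simp: N_def card_1_singleton_iff)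
  then obtain r where r: "\<And>x. x \<in> N \<Longrightarrow> fib x = {r x}" by metis
  have r': "e = r x \<longleftrightarrow> top e = x" if "x \<in> N" for x e using r[OF that] by (auto simp: fib_def)
  have "inj_on (fst \<circ> r) N"
  proof (rule inj_onI, rule ccontr)
    fix x y assume xy: "x \<in> N" "y \<in> N" "(fst \<circ> r) x = (fst \<circ> r) y" "x \<noteq> y"
    define i where "i = fst (r x)"
    have rx: "r x = (i, snd (r x))" and ry: "r y = (i, snd (r y))"
      using xy(3) by (simp_all add: i_def prod_eq_iff)
    have "top (r x) = x" "top (r y) = y" using r' xy(1,2) by blast+
    then have "r x \<noteq> r y" using xy(4) by auto
    then have ne: "snd (r x) \<noteq> snd (r y)" using xy(3) by (simp add: prod_eq_iff)
    have \<sigma>: "x \<in> \<sigma>" "y \<in> \<sigma>" using xy by (auto simp: N_def)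
    have above: "directed_coord (r z) f < directed_coord (r z) z" if z: "z \<in> N" for z
    proof -
      obtain e where e: "directed_coord e f < directed_coord e z" "top e = z"
        using single[of z] z by (auto simp: N_def)
      then have "e = r z" using r'[OF z] by blast
      then show ?thesis using e by blast
    qed
    obtain s where s: "\<forall>z\<in>{x,y}. \<exists>i. directed_coord (i, s i) f < directed_coord (i, s i) z \<and> top (i, s i) \<in> {x,y}"
      using cut[of "{x,y}"] \<sigma> by blast
    \<comment> \<open>Only \<open>r x\<close> and \<open>r y\<close> have their top in
      \<open>{x,y}\<close>, and both use coordinate \<open>i\<close>. The ball has one sign there,
      so \<open>x\<close> and \<open>y\<close> lie beyond \<open>f\<close> on the same side.\<close>
    have s': "directed_coord (i, s i) f < directed_coord (i, s i) z" if z: "z \<in> {x,y}" for z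
    proof -
      obtain j where j: "directed_coord (j, s j) f < directed_coord (j, s j) z" "top (j, s j) \<in> {x,y}"
        using s z by blast
      then have "(j, s j) = r x \<or> (j, s j) = r y" using r'[OF xy(1)] r'[OF xy(2)] by blast
      then have "j = i" using xy(3) by (auto simp: i_def prod_eq_iff)
      then show ?thesis using j by simp
    qed
    have "directed_coord (i, snd (r x)) f < directed_coord (i, snd (r x)) x"
      "directed_coord (i, snd (r y)) f < directed_coord (i, snd (r y)) y"
      using above[OF xy(1)] above[OF xy(2)] by (simp_all flip: rx ry)
    \<comment> \<open>The directions \<open>r x\<close> and \<open>r y\<close> are opposite, so
      \<open>above\<close> puts \<open>f\<close> strictly between \<open>x\<close> and
      \<open>y\<close> in coordinate \<open>i\<close>.\<close>
    then show False
      using s'[of x] s'[of y] ne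
      by (cases "s i"; cases "snd (r x)"; cases "snd (r y)") (auto simp: directed_coord_def)
  qed
  then have N: "card N \<le> CARD('n)" by (intro card_inj_on_le[of "fst \<circ> r" N UNIV]) auto
  have "(\<Sum>x\<in>\<sigma>. card (fib x)) = card (\<Union>x\<in>\<sigma>. fib x)"
    by (rule card_UN_disjoint[symmetric]) (use assms(2) in \<open>auto simp: fib_def\<close>)
  also have "(\<Union>x\<in>\<sigma>. fib x) = UNIV" using top by (auto simp: fib_def)
  finally have total: "(\<Sum>x\<in>\<sigma>. card (fib x)) = 2 * CARD('n)" by (simp add: card_prod)
  \<comment> \<open>Points outside \<open>N\<close> top at least two directions; those in
    \<open>N\<close> top one and are credited one more, at total cost \<open>card N\<close>.\<close>
  have "2 * card \<sigma> = (\<Sum>x\<in>\<sigma>. 2)" by simp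
  also have "\<dots> \<le> (\<Sum>x\<in>\<sigma>. card (fib x) + (if x \<in> N then 1 else 0))"
  proof (rule sum_mono)
    fix x assume x: "x \<in> \<sigma>"
    then have "fib x \<noteq> {}" using single unfolding fib_def by blast
    then have "card (fib x) \<ge> 1" by (simp add: Suc_le_eq card_gt_0_iff)
    then show "2 \<le> card (fib x) + (if x \<in> N then 1 else 0)" using x unfolding N_def by (cases "card (fib x) = 1") simp_all
  qed
  also have "\<dots> = 2 * CARD('n) + card (\<sigma> \<inter> N)"
    using assms(2) by (simp add: sum.distrib total sum.If_cases)
  also have "\<sigma> \<inter> N = N" by (auto simp: N_def)
  finally show ?thesis using N by simp
qed simp

lemma shattered_set_exists:
  fixes F :: "(real ^ 'n) set"
  assumes "bounded F"
  obtains \<sigma> where "finite \<sigma>" "shatters (degenerate_balls_containing F) \<sigma>"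
    "card \<sigma> = CARD('n) + CARD('n) div 2"
proof -
  obtain K where K: "K > 0" "\<And>x i. x \<in> F \<Longrightarrow> \<bar>x $ i\<bar> \<le> K"
    using assms unfolding bounded_pos by (meson component_le_norm_cart order_trans)
  obtain g :: "'n \<Rightarrow> nat" where g: "bij_betw g UNIV {..<CARD('n)}"
    using ex_bij_betw_finite_nat[of "UNIV :: 'n set"] by (auto simp: atLeast0LessThan)
  have g_lt: "g i < CARD('n)" for i using g by (auto simp: bij_betw_def)
  have g_surj: "\<exists>i. g i = m" if "m < CARD('n)" for m
    using g that unfolding bij_betw_def by (metis imageE lessThan_iff)
  \<comment> \<open>Coordinates \<open>2k\<close> and \<open>2k+1\<close> form pair
    \<open>k\<close>. \<open>Inl m\<close> is farthest out at its own coordinate,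
    \<open>Inr k\<close> is negative on the whole pair. For odd d the last coordinate has neither
    partner nor \<open>Inr\<close> point.\<close>
  define p :: "nat + nat \<Rightarrow> real ^ 'n" where
    "p = case_sum (\<lambda>m. \<chi> i. if g i = m then 3 * K else if g i div 2 = m div 2 then 2 * K else 0)
                  (\<lambda>k. \<chi> i. if g i div 2 = k then - 2 * K else 0)"
  define J where "J = {..<CARD('n)} <+> {..<CARD('n) div 2}"
  have main: "\<exists>C\<in>degenerate_balls_containing F. \<forall>j\<in>J. p j \<in> C \<longleftrightarrow> j \<in> A" if "A \<subseteq> J" for A
  proof -
    define S where "S = {m. m < CARD('n) \<and> Inl m \<notin> A}"
    define Z where "Z = {k. k < CARD('n) div 2 \<and> Inr k \<notin> A}"
    define q :: "nat \<Rightarrow> nat" where "q m = (if even m then m + 1 else m - 1)" for m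
    \<comment> \<open>All thresholds are at least \<open>K\<close> in absolute value, which keeps
      \<open>F\<close> inside. \<open>{..2*K}\<close> removes \<open>Inl m\<close> alone and
      \<open>{-K..}\<close> removes \<open>Inr k\<close>. If all three points of a pair must go,
      \<open>{..K}\<close> at the even coordinate removes both \<open>Inl\<close> points, freeing
      the odd one for \<open>{-K..}\<close>.\<close>
    define H where "H m = (if m div 2 \<in> Z then
        if m \<in> S then if q m \<in> S then if even m then {..K} else {-K..} else {..2*K} else {-K..}
        else if m \<in> S then {..2*K} else UNIV)" for m
    have q_div: "q m div 2 = m div 2" and q_ne: "q m \<noteq> m" and q_q: "q (q m) = m"
      and q_even: "even (q m) \<longleftrightarrow> odd m" for m
      by (auto simp: q_def elim!: evenE oddE)
    have q_cases: "m' = m \<or> m' = q m" if "m' div 2 = m div 2" for m m'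
      using that unfolding q_def by presburger
    have q_lt: "q m < CARD('n)" if "m div 2 < CARD('n) div 2" for m
      using that unfolding q_def by presburger
    define C where "C = {x :: real ^ 'n. \<forall>i. x $ i \<in> H (g i)}"
    have "degenerate_ball C"
      unfolding degenerate_ball_def C_def
      by (rule exI[of _ "\<lambda>i. H (g i)"]) (auto simp: H_def unbounded_closed_interval_def)
    moreover have "F \<subseteq> C"
    proof
      fix x assume "x \<in> F"
      then have "x $ i \<le> K \<and> - K \<le> x $ i" for i using K(2)[of x i] by auto
      then have "x $ i \<le> K" "- K \<le> x $ i" "x $ i \<le> 2 * K" for i using K(1) by (smt (verit))+
      then show "x \<in> C" by (auto simp: C_def H_def)
    qed
    ultimately have "C \<in> degenerate_balls_containing F" by (simp add: degenerate_balls_containing_def)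
    moreover have "p (Inl m) \<in> C \<longleftrightarrow> Inl m \<in> A" if m: "m < CARD('n)" for m
    proof
      assume "Inl m \<in> A"
      then have "m \<notin> S" by (simp add: S_def)
      have "p (Inl m) $ i \<in> H (g i)" for i
      proof (cases "g i div 2 = m div 2")
        case True
        then have "g i = m \<or> g i = q m" by (rule q_cases)
        \<comment> \<open>At the partner the upper bound is at worst \<open>2 * K\<close>, met with
          equality, since \<open>{..K}\<close> would require \<open>m \<in> S\<close>.\<close>
        then show ?thesis using K(1) \<open>m \<notin> S\<close> by (auto simp: p_def H_def q_q q_ne q_div)
      next
        case False
        then show ?thesis using K(1) by (auto simp: p_def H_def)
      qed
      then show "p (Inl m) \<in> C" by (simp add: C_def)
    next
      assume C: "p (Inl m) \<in> C"
      show "Inl m \<in> A"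
      proof (rule ccontr)
        assume "Inl m \<notin> A"
        then have S: "m \<in> S" using m by (simp add: S_def)
        obtain i where i: "g i = m" using g_surj m by blast
        have Hm: "3 * K \<in> H m" using C i by (auto simp: C_def p_def dest: spec[of _ i])
        \<comment> \<open>For \<open>m \<in> S\<close> only \<open>{-K..}\<close> admits
          \<open>3 * K\<close>; this is the case where the even partner carries
          \<open>{..K}\<close>.\<close>
        then have q: "q m \<in> S" "odd m" "m div 2 \<in> Z" using S K(1) by (auto simp: H_def split: if_splits)
        then obtain i' where i': "g i' = q m" using g_surj by (auto simp: S_def)
        have "2 * K \<in> H (q m)" using C i' by (auto simp: C_def p_def q_ne q_div dest: spec[of _ i'])
        then show False using q S K(1) by (auto simp: H_def q_q q_div q_even split: if_splits)
      qed
    qed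
    moreover have "p (Inr k) \<in> C \<longleftrightarrow> Inr k \<in> A" if k: "k < CARD('n) div 2" for k
    proof
      assume "Inr k \<in> A"
      then have "k \<notin> Z" by (simp add: Z_def)
      then show "p (Inr k) \<in> C" using K(1) by (auto simp: C_def p_def H_def)
    next
      assume C: "p (Inr k) \<in> C"
      show "Inr k \<in> A"
      proof (rule ccontr)
        assume "Inr k \<notin> A"
        then have Z: "k \<in> Z" using k by (simp add: Z_def)
        have H: "- 2 * K \<in> H m" if m: "m div 2 = k" "m < CARD('n)" for m
        proof -
          obtain i where "g i = m" using g_surj m by blast
          then show ?thesis using C m by (auto simp: C_def p_def dest: spec[of _ i])
        qed
        have "2 * k < CARD('n)" using k by presburger
        then have "- 2 * K \<in> H (2 * k)" "- 2 * K \<in> H (q (2 * k))"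
          using H[of "2 * k"] H[of "q (2 * k)"] q_lt[of "2 * k"] k by (auto simp: q_div)
        \<comment> \<open>Whichever coordinates of the pair are in \<open>S\<close>, at least one of
          the two carries \<open>{-K..}\<close>.\<close>
        then show False using Z K(1) by (auto simp: H_def q_div q_q q_even split: if_splits)
      qed
    qed
    ultimately show ?thesis by (intro bexI[of _ C]) (auto simp: J_def)
  qed
  show thesis
  proof (rule that[of "p ` J"])
    show "finite (p ` J)" by (simp add: J_def)
    show "shatters (degenerate_balls_containing F) (p ` J)" by (rule shatters_imageI(1)[OF main])
    have "inj_on p J" by (rule shatters_imageI(2)[OF main])
    then show "card (p ` J) = CARD('n) + CARD('n) div 2"
      by (simp add: card_image) (simp add: J_def card_Plus)
  qed
qed

theorem theoremA:
  fixes F :: "(real ^ 'n) set"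
  assumes "F \<noteq> {}" and "bounded F"
  shows "VC_dim (degenerate_balls_containing F) = enat (nat \<lfloor>3 * real CARD('n) / 2\<rfloor>)"
proof -
  have "\<lfloor>3 * real CARD('n) / 2\<rfloor> = int (3 * CARD('n) div 2)"
    using floor_divide_of_nat_eq[of "3 * CARD('n)" 2, where 'a = real] by simp
  then have n: "nat \<lfloor>3 * real CARD('n) / 2\<rfloor> = CARD('n) + CARD('n) div 2" by simp
  obtain \<sigma> where \<sigma>: "finite \<sigma>" "shatters (degenerate_balls_containing F) \<sigma>"
    "card \<sigma> = CARD('n) + CARD('n) div 2"
    using shattered_set_exists[OF assms(2)] by blast
  show ?thesis
    unfolding n using \<sigma>
  proof (rule VC_dim_eqI)
    fix \<tau> assume "finite \<tau>" "shatters (degenerate_balls_containing F) \<tau>"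
    then show "card \<tau> \<le> CARD('n) + CARD('n) div 2"
      using shattered_card_bound[OF assms(1)] by fastforce
  qed
qed

end
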